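(* There is an absolute constant $C>0$ such that the following holds. Let $n\ge 1$ and let $X\in\mathbb{R}^{n\times n}$ be positive semidefinite with $X_{ii}=1$ for all $i\in[n]$. Put $\alpha_{\mathrm{spec}}:=\|X\|_2$, $\alpha_{\mathrm{row}}:=\max_{i\in[n]}\sqrt{\sum_{j\neq i}X_{ij}^2}$, $\alpha_{\mathrm{mag}}:=\max_{i\neq j}|X_{ij}|$, and $\alpha:=C\,\alpha_{\mathrm{mag}}(1+\alpha_{\mathrm{row}}^4)(1+\alpha_{\mathrm{spec}}^2)$. Let $\mathcal{M}^{(1)}=\mathcal{M}^{(1)}(X)$ be the matrix defined in the context and set $$\Phi(X):=\frac{1}{1+\alpha}\mathcal{M}^{(1)}+\frac{\alpha}{1+\alpha}\,\mathrm{Id}.$$ Then for every real symmetric matrix $A\in\mathbb{R}^{n\times n}$, $$\sum_{i,j\in[n]}A_{ij}\,\Phi(X)[\{i\},\{j\}]\;\ge\;\frac{1}{1+\alpha}\sum_{i,j}A_{ij}X_{ij}\;-\;\frac{\alpha}{1+\alpha}\Big(\sqrt{n}\,\|A\|_F-\mathrm{Tr}(A)\Big).$$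
   Context: Construction of $\mathcal{M}^{(1)}$: Fix any $M\in\mathbb{R}^{n\times n}$ with $X=MM^{\top}$ (e.g. a Cholesky factor). For each $\kappa\ge n$ that is a power of $2$, let $H_\kappa$ be the $\kappa\times\kappa$ Sylvester Hadamard matrix normalized to be orthogonal (entries $\pm1/\sqrt{\kappa}$), let $H_\kappa^{\le n}$ be its first $n$ rows, and let $M_\kappa:=MH_\kappa^{\le n}\in\mathbb{R}^{n\times\kappa}$. For indeterminates $z=(z_1,\dots,z_\kappa)$ with $z_j^2=1$ and $i\in[n]$ define $$q_{i,\kappa}(z):=\sum_{j\in[\kappa]}M_\kappa[i,j]z_j-2\sum_{\{j_1,j_2,j_3\}\subseteq[\kappa]}M_\kappa[i,j_1]M_\kappa[i,j_2]M_\kappa[i,j_3]z_{j_1}z_{j_2}z_{j_3},$$ and for $S\subseteq[n]$ let $q_{S,\kappa}:=\prod_{i\in S}q_{i,\kappa}$ (with $q_{\emptyset,\kappa}=1$). $\mathcal{M}^{(1)}$ is the matrix with rows and columns indexed by subsets of $[n]$ of size at most $2$, with $\mathcal{M}^{(1)}[S,T]:=\lim_{\kappa\to\infty}\mathbb{E}_{z\sim\{\pm1\}^\kappa\text{ uniform}}[q_{S\Delta T,\kappa}(z)]$ (limit over powers of $2$; these limits exist). $\mathrm{Id}$ is the identity matrix of the same index set, and $\|\cdot\|_F$ is the Frobenius norm. *)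

theory Defs
  imports
    "HOL-Probability.Probability_Mass_Function"
    "Jordan_Normal_Form.Matrix"
begin

no_notation inner (infix \<open>\<bullet>\<close> 70)

text \<open>
  The index set \<open>[n]\<close> is \<open>{..<n}\<close>. All dimensions are natural numbers (rather than types),
  because the absolute constant has to be chosen before \<open>n\<close>.
\<close>

definition symmetric_mat :: "real mat \<Rightarrow> bool" where
  "symmetric_mat A \<longleftrightarrow> transpose_mat A = A"

definition psd_mat :: "real mat \<Rightarrow> bool" where
  "psd_mat A \<longleftrightarrow> symmetric_mat A \<and> (\<forall>v \<in> carrier_vec (dim_col A). 0 \<le> v \<bullet> (A *\<^sub>v v))"

definition spec_norm :: "real mat \<Rightarrow> real" where
  "spec_norm A = Sup {sqrt ((A *\<^sub>v v) \<bullet> (A *\<^sub>v v)) | v. v \<in> carrier_vec (dim_col A) \<and> v \<bullet> v \<le> 1}"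

definition frob_norm :: "real mat \<Rightarrow> real" where
  "frob_norm A = sqrt (\<Sum>i<dim_row A. \<Sum>j<dim_col A. (A $$ (i, j))\<^sup>2)"

definition trace_mat :: "real mat \<Rightarrow> real" where
  "trace_mat A = (\<Sum>i<dim_row A. A $$ (i, i))"

definition alpha_row :: "nat \<Rightarrow> real mat \<Rightarrow> real" where
  "alpha_row n X = Max ((\<lambda>i. sqrt (\<Sum>j\<in>{..<n} - {i}. (X $$ (i, j))\<^sup>2)) ` {..<n})"

text \<open>
  Inserting \<open>0\<close> only matters for \<open>n = 1\<close>, where there are no off-diagonal entries:
  the maximum of the empty family of nonnegative numbers is taken to be \<open>0\<close>.
\<close>

definition alpha_mag :: "nat \<Rightarrow> real mat \<Rightarrow> real" where
  "alpha_mag n X = Max (insert 0 {\<bar>X $$ (i, j)\<bar> | i j. i < n \<and> j < n \<and> i \<noteq> j})"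

definition alpha :: "real \<Rightarrow> nat \<Rightarrow> real mat \<Rightarrow> real" where
  "alpha C n X = C * alpha_mag n X * (1 + alpha_row n X ^ 4) * (1 + (spec_norm X)\<^sup>2)"

text \<open>
  Everything below that depends on \<open>\<kappa>\<close> is parametrised by the exponent \<open>k\<close> with \<open>\<kappa> = 2 ^ k\<close>.
\<close>

fun sylvester :: "nat \<Rightarrow> real mat" where
  "sylvester 0 = 1\<^sub>m 1"
| "sylvester (Suc k) =
    four_block_mat (sylvester k) (sylvester k) (sylvester k) (- sylvester k)"

definition hadamard :: "nat \<Rightarrow> real mat" where
  "hadamard k = (1 / sqrt (2 ^ k)) \<cdot>\<^sub>m sylvester k"

text \<open>
  The first \<open>n\<close> rows only make sense for \<open>n \<le> 2 ^ k\<close>; the finitely many smaller \<open>k\<close>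
  do not influence the limit below.
\<close>

definition hadamard_rows :: "nat \<Rightarrow> nat \<Rightarrow> real mat" where
  "hadamard_rows n k = mat n (2 ^ k) (\<lambda>(i, j). hadamard k $$ (i, j))"

definition M_kappa :: "nat \<Rightarrow> real mat \<Rightarrow> nat \<Rightarrow> real mat" where
  "M_kappa n M k = M * hadamard_rows n k"

text \<open>
  Polynomials in \<open>z\<close> modulo \<open>z\<^sub>j\<^sup>2 = 1\<close> are represented as functions of \<open>z \<in> {-1, 1}\<^sup>\<kappa>\<close>.
\<close>

definition q_single :: "nat \<Rightarrow> real mat \<Rightarrow> nat \<Rightarrow> nat \<Rightarrow> (nat \<Rightarrow> real) \<Rightarrow> real" where
  "q_single n M k i z =
    (\<Sum>j<2 ^ k. M_kappa n M k $$ (i, j) * z j)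
    - 2 * (\<Sum>J | J \<subseteq> {..<2 ^ k} \<and> card J = 3. \<Prod>j\<in>J. M_kappa n M k $$ (i, j) * z j)"

definition q_set :: "nat \<Rightarrow> real mat \<Rightarrow> nat \<Rightarrow> nat set \<Rightarrow> (nat \<Rightarrow> real) \<Rightarrow> real" where
  "q_set n M k S z = (\<Prod>i\<in>S. q_single n M k i z)"

definition uniform_signs :: "nat \<Rightarrow> (nat \<Rightarrow> real) pmf" where
  "uniform_signs \<kappa> = pmf_of_set ({..<\<kappa>} \<rightarrow>\<^sub>E {-1, 1})"

text \<open>
  Matrices indexed by the subsets of \<open>[n]\<close> of size at most \<open>2\<close> are functions on pairs of such
  subsets, undefined elsewhere.
\<close>

definition index_sets :: "nat \<Rightarrow> nat set set" where
  "index_sets n = {S. S \<subseteq> {..<n} \<and> card S \<le> 2}"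

definition M1 :: "nat \<Rightarrow> real mat \<Rightarrow> nat set \<times> nat set \<Rightarrow> real" where
  "M1 n M = (\<lambda>(S, T) \<in> index_sets n \<times> index_sets n.
    lim (\<lambda>k. measure_pmf.expectation (uniform_signs (2 ^ k)) (q_set n M k (sym_diff S T))))"

definition Id_sets :: "nat \<Rightarrow> nat set \<times> nat set \<Rightarrow> real" where
  "Id_sets n = (\<lambda>(S, T) \<in> index_sets n \<times> index_sets n. if S = T then 1 else 0)"

definition Phi :: "nat \<Rightarrow> real \<Rightarrow> real mat \<Rightarrow> nat set \<times> nat set \<Rightarrow> real" where
  "Phi n a M = (\<lambda>P \<in> index_sets n \<times> index_sets n.
    1 / (1 + a) * M1 n M P + a / (1 + a) * Id_sets n P)"

end

theory Submission
  imports Defs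
begin

text \<open>
  Since the rows of \<open>M\<^sub>\<kappa>\<close> have inner products \<open>X\<^sub>i\<^sub>j\<close> and entries of order \<open>\<kappa>\<^bsup>-1/2\<^esup>\<close>, orthogonality of
  characters gives \<open>E[q\<^sub>i q\<^sub>j] = X\<^sub>i\<^sub>j + 4 e\<^sub>3\<close>, where \<open>e\<^sub>3\<close> is the elementary symmetric polynomial in the
  products of corresponding entries of rows \<open>i\<close> and \<open>j\<close>. Newton's identity expresses \<open>6 e\<^sub>3\<close> by power
  sums, of which only the cube \<open>X\<^sub>i\<^sub>j\<^sup>3\<close> of the first one survives in the limit. Hence the off-diagonal
  error is \<open>(2/3) X\<^sub>i\<^sub>j\<^sup>3\<close>, and Cauchy-Schwarz together with \<open>\<alpha>\<^sub>m\<^sub>a\<^sub>g \<le> \<alpha>\<^sub>r\<^sub>o\<^sub>w\<close> bounds its pairing with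
  \<open>A\<close>; the constant \<open>C = 1\<close> suffices.
\<close>

section \<open>Sylvester matrices and the entries and Gram matrix of \<open>M_kappa\<close>\<close>

lemma sylvester_carrier [simp]:
  "dim_row (sylvester k) = 2 ^ k" "dim_col (sylvester k) = 2 ^ k"
  by (induction k) auto

lemma sylvester_Suc_index:
  assumes "i < 2 ^ Suc k" "j < 2 ^ Suc k"
  shows "sylvester (Suc k) $$ (i, j) =
    (if i < 2 ^ k then if j < 2 ^ k then sylvester k $$ (i, j) else sylvester k $$ (i, j - 2 ^ k)
     else if j < 2 ^ k then sylvester k $$ (i - 2 ^ k, j)
     else - sylvester k $$ (i - 2 ^ k, j - 2 ^ k))"
  using assms by (auto simp: four_block_mat_def Let_def)

lemma abs_sylvester:
  "i < 2 ^ k \<Longrightarrow> j < 2 ^ k \<Longrightarrow> \<bar>sylvester k $$ (i, j)\<bar> = 1"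
proof (induction k arbitrary: i j)
  case (Suc k)
  then show ?case
    by (subst sylvester_Suc_index) (auto simp: algebra_simps)
qed simp

lemma sum_lessThan_double:
  fixes f :: "nat \<Rightarrow> 'a::comm_monoid_add"
  shows "(\<Sum>j<m + m. f j) = (\<Sum>j<m. f j) + (\<Sum>j<m. f (j + m))"
  using sum.atLeastLessThan_concat[of 0 m "m + m" f]
    sum.shift_bounds_nat_ivl[of f 0 m m]
  by (simp add: lessThan_atLeast0)

text \<open>By the block recursion, both halves of a row at level \<open>Suc k\<close> are, up to
  sign, the same row at level \<open>k\<close>. The inner product therefore splits into two copies
  of a smaller one, which add up or cancel according to the signs.\<close>

lemma sylvester_orthogonal:
  assumes "i < 2 ^ k" "i' < 2 ^ k"
  shows "(\<Sum>j<2 ^ k. sylvester k $$ (i, j) * sylvester k $$ (i', j)) =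
    (if i = i' then 2 ^ k else 0)"
  using assms
proof (induction k arbitrary: i i')
  case (Suc k)
  let ?s = "\<lambda>i j. sylvester k $$ (i, j)"
  let ?S = "\<lambda>i j. sylvester (Suc k) $$ (i, j)"
  \<comment> \<open>\<open>?r\<close> gives the row of the smaller matrix that is repeated, and
    \<open>?e\<close> is the product of the signs that rows \<open>i\<close> and \<open>i'\<close>
    carry in their right halves. The total is \<open>1 + ?e\<close> times the smaller inner
    product.\<close>
  let ?r = "\<lambda>i. if i < 2 ^ k then i else i - 2 ^ k"
  let ?e = "(if i < 2 ^ k then 1 else - 1) * (if i' < 2 ^ k then 1 else - 1 :: real)"
  have r: "?r i < 2 ^ k" "?r i' < 2 ^ k"
    using Suc.prems by auto
  have "(\<Sum>j<2 ^ Suc k. ?S i j * ?S i' j) =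
      (\<Sum>j<2 ^ k. ?S i j * ?S i' j) + (\<Sum>j<2 ^ k. ?S i (j + 2 ^ k) * ?S i' (j + 2 ^ k))"
    using sum_lessThan_double[of "\<lambda>j. ?S i j * ?S i' j" "2 ^ k"] by (simp add: mult_2)
  also have "(\<Sum>j<2 ^ k. ?S i j * ?S i' j) = (\<Sum>j<2 ^ k. ?s (?r i) j * ?s (?r i') j)"
    using Suc.prems by (intro sum.cong refl) (simp add: sylvester_Suc_index del: sylvester.simps)
  also have "(\<Sum>j<2 ^ k. ?S i (j + 2 ^ k) * ?S i' (j + 2 ^ k)) =
      (\<Sum>j<2 ^ k. ?e * (?s (?r i) j * ?s (?r i') j))"
    using Suc.prems by (intro sum.cong refl) (simp add: sylvester_Suc_index del: sylvester.simps)
  finally have "(\<Sum>j<2 ^ Suc k. ?S i j * ?S i' j) = (1 + ?e) * (if ?r i = ?r i' then 2 ^ k else 0)"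
    unfolding sum_distrib_left[symmetric] Suc.IH[OF r] by (simp add: algebra_simps)
  \<comment> \<open>If the rows lie in different blocks, then \<open>?e = - 1\<close> kills the sum.
    If they lie in the same block, then \<open>1 + ?e = 2\<close> doubles it, and
    \<open>?r i = ?r i'\<close> is equivalent to \<open>i = i'\<close>.\<close>
  then show ?case
    using Suc.prems by (auto split: if_splits)
qed simp

lemma hadamard_rows_orthogonal:
  assumes "n \<le> 2 ^ k" "l < n" "l' < n"
  shows "(\<Sum>j<2 ^ k. hadamard_rows n k $$ (l, j) * hadamard_rows n k $$ (l', j)) =
    (if l = l' then 1 else 0)"
proof -
  have "(\<Sum>j<2 ^ k. hadamard_rows n k $$ (l, j) * hadamard_rows n k $$ (l', j)) =
      (\<Sum>j<2 ^ k. (1 / 2 ^ k) * (sylvester k $$ (l, j) * sylvester k $$ (l', j)))"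
    using assms by (intro sum.cong refl) (simp add: hadamard_rows_def hadamard_def)
  also have "\<dots> = (1 / 2 ^ k) * (if l = l' then 2 ^ k else 0)"
    using assms by (subst sum_distrib_left[symmetric], subst sylvester_orthogonal) auto
  finally show ?thesis by simp
qed

lemma abs_hadamard_rows:
  assumes "n \<le> 2 ^ k" "l < n" "j < 2 ^ k"
  shows "\<bar>hadamard_rows n k $$ (l, j)\<bar> = 1 / sqrt (2 ^ k)"
  using assms by (simp add: hadamard_rows_def hadamard_def abs_mult abs_sylvester)

lemma M_kappa_index:
  assumes "M \<in> carrier_mat n n" "i < n" "j < 2 ^ k"
  shows "M_kappa n M k $$ (i, j) = (\<Sum>l<n. M $$ (i, l) * hadamard_rows n k $$ (l, j))"
  using assms
  by (auto simp: M_kappa_def scalar_prod_def hadamard_rows_def lessThan_atLeast0 intro!: sum.cong)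

text \<open>The chosen rows \<open>H\<close> of the Hadamard matrix are orthonormal, so
  \<open>(M H) (M H)^T = M (H H^T) M^T = M M^T\<close>. This is exact as soon as
  \<open>n \<le> 2 ^ k\<close>, before any limit.\<close>

lemma M_kappa_row_product:
  assumes M: "M \<in> carrier_mat n n" and i: "i < n" "i' < n" and k: "n \<le> 2 ^ k"
  shows "(\<Sum>j<2 ^ k. M_kappa n M k $$ (i, j) * M_kappa n M k $$ (i', j)) =
    (M * transpose_mat M) $$ (i, i')"
proof -
  let ?H = "\<lambda>l j. hadamard_rows n k $$ (l, j)"
  have "(\<Sum>j<2 ^ k. M_kappa n M k $$ (i, j) * M_kappa n M k $$ (i', j)) =
      (\<Sum>j<2 ^ k. \<Sum>l<n. \<Sum>l'<n. M $$ (i, l) * M $$ (i', l') * (?H l j * ?H l' j))"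
    using M i by (intro sum.cong refl) (simp add: M_kappa_index sum_product ac_simps)
  also have "\<dots> = (\<Sum>l<n. \<Sum>j<2 ^ k. \<Sum>l'<n. M $$ (i, l) * M $$ (i', l') * (?H l j * ?H l' j))"
    by (rule sum.swap)
  also have "\<dots> = (\<Sum>l<n. \<Sum>l'<n. \<Sum>j<2 ^ k. M $$ (i, l) * M $$ (i', l') * (?H l j * ?H l' j))"
    by (intro sum.cong refl sum.swap)
  also have "\<dots> = (\<Sum>l<n. \<Sum>l'<n. M $$ (i, l) * M $$ (i', l') * (if l = l' then 1 else 0))"
    using k by (intro sum.cong refl) (simp add: sum_distrib_left[symmetric] hadamard_rows_orthogonal)
  also have "\<dots> = (\<Sum>l<n. M $$ (i, l) * M $$ (i', l))"
    by (simp add: if_distrib[of "\<lambda>x. _ * x"] cong: if_cong)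
  also have "\<dots> = (M * transpose_mat M) $$ (i, i')"
    using M i by (auto simp: scalar_prod_def lessThan_atLeast0 intro!: sum.cong)
  finally show ?thesis .
qed

text \<open>All Hadamard entries have the same size, so the mass of each row of
  \<open>M_kappa\<close> is spread out. The numerator does not depend on \<open>k\<close>, which is
  what makes the higher power sums vanish in the limit.\<close>

lemma abs_M_kappa_le:
  assumes "M \<in> carrier_mat n n" "i < n" "j < 2 ^ k" "n \<le> 2 ^ k"
  shows "\<bar>M_kappa n M k $$ (i, j)\<bar> \<le> (\<Sum>l<n. \<bar>M $$ (i, l)\<bar>) / sqrt (2 ^ k)"
proof -
  have "\<bar>M_kappa n M k $$ (i, j)\<bar> \<le> (\<Sum>l<n. \<bar>M $$ (i, l) * hadamard_rows n k $$ (l, j)\<bar>)"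
    using assms by (simp add: M_kappa_index sum_abs)
  also have "\<dots> = (\<Sum>l<n. \<bar>M $$ (i, l)\<bar>) / sqrt (2 ^ k)"
    using assms by (simp add: abs_mult abs_hadamard_rows sum_divide_distrib)
  finally show ?thesis .
qed

section \<open>Elementary symmetric polynomials and Newton's identities\<close>

definition elem_sym :: "nat \<Rightarrow> ('a \<Rightarrow> 'b::comm_semiring_1) \<Rightarrow> 'a set \<Rightarrow> 'b" where
  "elem_sym r a A = (\<Sum>J | J \<subseteq> A \<and> card J = r. \<Prod>j\<in>J. a j)"

text \<open>The subsets of \<open>insert x A\<close> split into those avoiding \<open>x\<close> and
  those arising by adding \<open>x\<close> to a smaller subset of \<open>A\<close>. This recursion
  drives the inductions for degrees 2 and 3.\<close>

lemma elem_sym_insert: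
  assumes "finite A" "x \<notin> A"
  shows "elem_sym (Suc r) a (insert x A) = elem_sym (Suc r) a A + a x * elem_sym r a A"
proof -
  let ?U = "{J. J \<subseteq> A \<and> card J = Suc r}" and ?V = "{J. J \<subseteq> A \<and> card J = r}"
  have eq: "{J. J \<subseteq> insert x A \<and> card J = Suc r} = ?U \<union> insert x ` ?V"
  proof (intro equalityI subsetI)
    fix J assume J: "J \<in> {J. J \<subseteq> insert x A \<and> card J = Suc r}"
    then have "finite J"
      using assms(1) finite_subset by blast
    show "J \<in> ?U \<union> insert x ` ?V"
    proof (cases "x \<in> J")
      case True
      then have "J = insert x (J - {x})" "J - {x} \<in> ?V"
        using J \<open>finite J\<close> by auto
      then show ?thesis by blast
    qed (use J in auto)
  next
    fix J assume "J \<in> ?U \<union> insert x ` ?V"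
    then show "J \<in> {J. J \<subseteq> insert x A \<and> card J = Suc r}"
      using assms by (auto simp: card_insert_if finite_subset)
  qed
  have "inj_on (insert x) ?V"
    using assms(2) by (auto simp: inj_on_def)
  moreover have "(\<Prod>j\<in>insert x J. a j) = a x * (\<Prod>j\<in>J. a j)" if "J \<in> ?V" for J
    using that assms by (subst prod.insert) (auto intro: finite_subset)
  moreover have "?U \<inter> insert x ` ?V = {}"
    using assms(2) by auto
  ultimately show ?thesis
    using assms(1) unfolding elem_sym_def eq
    by (subst sum.union_disjoint) (auto simp: sum.reindex sum_distrib_left)
qed

lemma elem_sym_1:
  assumes "finite A"
  shows "elem_sym (Suc 0) a A = sum a A"
proof -
  have "{J. J \<subseteq> A \<and> card J = Suc 0} = (\<lambda>j. {j}) ` A"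
    by (auto simp: card_Suc_eq)
  then show ?thesis
    by (simp add: elem_sym_def sum.reindex)
qed

lemma elem_sym_2:
  fixes a :: "'a \<Rightarrow> 'b::comm_ring_1"
  assumes "finite A"
  shows "2 * elem_sym 2 a A = (\<Sum>j\<in>A. a j)\<^sup>2 - (\<Sum>j\<in>A. (a j)\<^sup>2)"
  using assms
proof (induction A)
  case empty
  have none: "{J. J = {} \<and> card J = 2} = ({} :: 'a set set)" by auto
  show ?case by (simp add: elem_sym_def none del: sum_constant)
next
  case (insert x A)
  then have "elem_sym 2 a (insert x A) = elem_sym 2 a A + a x * sum a A"
    using elem_sym_insert[of A x 1 a] by (simp add: numeral_2_eq_2 elem_sym_1)
  with insert show ?case
    by (simp add: algebra_simps power2_eq_square)
qed

text \<open>Newton's identity with denominators cleared, so that it holds in any commutative ring.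
  The factor 6 splits as \<open>3 * 2\<close> in the induction step, to match the 2 in
  \<open>elem_sym_2\<close>.\<close>

lemma elem_sym_3:
  fixes a :: "'a \<Rightarrow> 'b::comm_ring_1"
  assumes "finite A"
  shows "6 * elem_sym 3 a A =
    (\<Sum>j\<in>A. a j) ^ 3 - 3 * (\<Sum>j\<in>A. a j) * (\<Sum>j\<in>A. (a j)\<^sup>2) + 2 * (\<Sum>j\<in>A. a j ^ 3)"
  using assms
proof (induction A)
  case empty
  have none: "{J. J = {} \<and> card J = 3} = ({} :: 'a set set)" by auto
  show ?case by (simp add: elem_sym_def none del: sum_constant)
next
  case (insert x A)
  have "elem_sym 3 a (insert x A) = elem_sym 3 a A + a x * elem_sym 2 a A"
    using insert elem_sym_insert[of A x 2 a] by (simp add: eval_nat_numeral)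
  then have "6 * elem_sym 3 a (insert x A) = 6 * elem_sym 3 a A + 3 * a x * (2 * elem_sym 2 a A)"
    by (simp add: algebra_simps)
  then show ?case
    using insert by (simp add: elem_sym_2 algebra_simps power2_eq_square power3_eq_cube)
qed

section \<open>Orthogonality of characters under uniform signs\<close>

lemma finite_signs: "finite ({..<N::nat} \<rightarrow>\<^sub>E {-1, 1::real})"
  and signs_nonempty: "({..<N::nat} \<rightarrow>\<^sub>E {-1, 1::real}) \<noteq> {}"
  by (auto intro!: finite_PiE simp: PiE_eq_empty_iff)

lemma expectation_uniform_signs:
  "measure_pmf.expectation (uniform_signs N) f =
    (\<Sum>z\<in>{..<N} \<rightarrow>\<^sub>E {-1, 1}. f z) / card ({..<N} \<rightarrow>\<^sub>E {-1, 1::real})"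
  for f :: "(nat \<Rightarrow> real) \<Rightarrow> real"
  unfolding uniform_signs_def by (rule integral_pmf_of_set[OF signs_nonempty finite_signs])

lemma sum_signs_prod:
  fixes N :: nat
  assumes "J \<subseteq> {..<N}" "J \<noteq> {}"
  shows "(\<Sum>z\<in>{..<N} \<rightarrow>\<^sub>E {-1, 1::real}. \<Prod>j\<in>J. z j) = 0"
proof -
  have "(\<Sum>z\<in>{..<N} \<rightarrow>\<^sub>E {-1, 1::real}. \<Prod>j\<in>J. z j) =
      (\<Sum>z\<in>{..<N} \<rightarrow>\<^sub>E {-1, 1::real}. \<Prod>j<N. if j \<in> J then z j else 1)"
    using assms by (intro sum.cong refl prod.mono_neutral_cong_left) auto
  \<comment> \<open>With the product padded by ones to all coordinates, the sum over sign vectors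
    factorises. Each factor with \<open>j \<in> J\<close> is \<open>-1 + 1 = 0\<close>, and
    \<open>J\<close> is nonempty.\<close>
  also have "\<dots> = (\<Prod>j<N. \<Sum>y\<in>{-1, 1::real}. if j \<in> J then y else 1)"
    by (rule prod_sum_PiE[symmetric]) auto
  also have "\<dots> = 0"
    using assms by (intro prod_zero) auto
  finally show ?thesis .
qed

text \<open>On sign vectors \<open>z j * z j = 1\<close> cancels the common indices, which leaves
  the character of the symmetric difference. Its mean is 0 unless it is the empty product.\<close>

lemma expectation_characters:
  assumes "J \<subseteq> {..<N}" "K \<subseteq> {..<N}"
  shows "measure_pmf.expectation (uniform_signs N) (\<lambda>z. (\<Prod>j\<in>J. z j) * (\<Prod>j\<in>K. z j)) =
    (if J = K then 1 else 0)"
proof -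
  have eq: "(\<Prod>j\<in>J. z j) * (\<Prod>j\<in>K. z j) = (\<Prod>j\<in>sym_diff J K. z j)"
    if "z \<in> {..<N} \<rightarrow>\<^sub>E {-1, 1::real}" for z
  proof -
    have fin: "finite J" "finite K"
      using assms finite_subset by auto
    have sq: "z j * z j = 1" if "j \<in> J" for j
      using that assms \<open>z \<in> _\<close> by (force simp: PiE_iff)
    have "(\<Prod>j\<in>J. z j) = (\<Prod>j\<in>J - K. z j) * (\<Prod>j\<in>J \<inter> K. z j)"
      using prod.Int_Diff[of J z K] fin by (simp add: mult.commute)
    moreover have "(\<Prod>j\<in>K. z j) = (\<Prod>j\<in>K - J. z j) * (\<Prod>j\<in>J \<inter> K. z j)"
      using prod.Int_Diff[of K z J] fin by (simp add: mult.commute Int_commute)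
    moreover have "(\<Prod>j\<in>J \<inter> K. z j) * (\<Prod>j\<in>J \<inter> K. z j) = 1"
      using sq by (simp add: prod.distrib[symmetric])
    moreover have "(\<Prod>j\<in>sym_diff J K. z j) = (\<Prod>j\<in>J - K. z j) * (\<Prod>j\<in>K - J. z j)"
      using fin by (intro prod.union_disjoint) auto
    ultimately show ?thesis
      by (metis (no_types, lifting) mult.assoc mult.commute mult_1)
  qed
  show ?thesis
  proof (cases "J = K")
    case True
    then have "(\<Sum>z\<in>{..<N} \<rightarrow>\<^sub>E {-1, 1::real}. (\<Prod>j\<in>J. z j) * (\<Prod>j\<in>K. z j)) =
        card ({..<N} \<rightarrow>\<^sub>E {-1, 1::real})"
      using eq by simp
    then show ?thesis
      using True by (simp add: expectation_uniform_signs card_PiE)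
  next
    case False
    then have "(\<Sum>z\<in>{..<N} \<rightarrow>\<^sub>E {-1, 1::real}. (\<Prod>j\<in>J. z j) * (\<Prod>j\<in>K. z j)) = 0"
      using sum_signs_prod[of "sym_diff J K" N] assms by (subst sum.cong[OF refl eq]) auto
    then show ?thesis
      using False by (simp add: expectation_uniform_signs)
  qed
qed

text \<open>Parseval's identity for multilinear polynomials supported on the family
  \<open>F\<close>: only the diagonal pairs \<open>J = K\<close> survive.\<close>

lemma expectation_multilinear_product:
  assumes "finite F" "\<And>J. J \<in> F \<Longrightarrow> J \<subseteq> {..<N}"
  shows "measure_pmf.expectation (uniform_signs N)
      (\<lambda>z. (\<Sum>J\<in>F. c J * (\<Prod>j\<in>J. z j)) * (\<Sum>K\<in>F. d K * (\<Prod>j\<in>K. z j))) =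
    (\<Sum>J\<in>F. c J * d J)"
proof -
  let ?E = "measure_pmf.expectation (uniform_signs N)"
  have int: "integrable (measure_pmf (uniform_signs N)) f" for f :: "(nat \<Rightarrow> real) \<Rightarrow> real"
    by (rule integrable_measure_pmf_finite)
      (simp add: uniform_signs_def set_pmf_of_set[OF signs_nonempty finite_signs] finite_signs)
  have "?E (\<lambda>z. (\<Sum>J\<in>F. c J * (\<Prod>j\<in>J. z j)) * (\<Sum>K\<in>F. d K * (\<Prod>j\<in>K. z j))) =
      ?E (\<lambda>z. \<Sum>J\<in>F. \<Sum>K\<in>F. c J * d K * ((\<Prod>j\<in>J. z j) * (\<Prod>j\<in>K. z j)))"
    by (simp add: sum_product ac_simps)
  also have "\<dots> = (\<Sum>J\<in>F. \<Sum>K\<in>F. c J * d K * ?E (\<lambda>z. (\<Prod>j\<in>J. z j) * (\<Prod>j\<in>K. z j)))"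
    by (simp add: Bochner_Integration.integral_sum int)
  also have "\<dots> = (\<Sum>J\<in>F. \<Sum>K\<in>F. c J * d K * (if J = K then 1 else 0))"
    using assms by (intro sum.cong refl) (simp add: expectation_characters)
  also have "\<dots> = (\<Sum>J\<in>F. c J * d J)"
    using assms by (simp add: if_distrib[of "\<lambda>x. _ * x"] cong: if_cong)
  finally show ?thesis .
qed

section \<open>Pair moments of the polynomials \<open>q_single\<close> and their limit\<close>

lemma expectation_q_single_product:
  "measure_pmf.expectation (uniform_signs (2 ^ k)) (\<lambda>z. q_single n M k i z * q_single n M k i' z) =
    (\<Sum>j<2 ^ k. M_kappa n M k $$ (i, j) * M_kappa n M k $$ (i', j)) +
    4 * elem_sym 3 (\<lambda>j. M_kappa n M k $$ (i, j) * M_kappa n M k $$ (i', j)) {..<2 ^ k}"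
proof -
  let ?N = "{..<2 ^ k :: nat}"
  let ?m = "\<lambda>i j. M_kappa n M k $$ (i, j)"
  let ?F = "\<lambda>r. {J. J \<subseteq> ?N \<and> card J = r}"
  \<comment> \<open>These are the Fourier coefficients of \<open>q_single\<close>, which is
    supported on sets of size 1 and 3. On triples the factor \<open>- 2\<close> occurs in both
    polynomials and yields the 4 in front of \<open>elem_sym 3\<close>.\<close>
  define c where "c i J = (if card J = 3 then - 2 else 1) * (\<Prod>j\<in>J. ?m i j)" for i J
  have fin: "finite (?F r)" for r by simp
  have disj: "?F 1 \<inter> ?F 3 = {}" by auto
  have q: "q_single n M k i z = (\<Sum>J\<in>?F 1 \<union> ?F 3. c i J * (\<Prod>j\<in>J. z j))" for i z
  proof -
    have "(\<Sum>J\<in>?F 1. c i J * (\<Prod>j\<in>J. z j)) = elem_sym (Suc 0) (\<lambda>j. ?m i j * z j) ?N"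
      unfolding elem_sym_def by (intro sum.cong) (auto simp: c_def prod.distrib)
    moreover have "(\<Sum>J\<in>?F 3. c i J * (\<Prod>j\<in>J. z j)) = - 2 * (\<Sum>J\<in>?F 3. \<Prod>j\<in>J. ?m i j * z j)"
      unfolding sum_distrib_left by (intro sum.cong) (auto simp: c_def prod.distrib)
    ultimately show ?thesis
      unfolding sum.union_disjoint[OF fin fin disj] q_single_def by (simp add: elem_sym_1)
  qed
  have "measure_pmf.expectation (uniform_signs (2 ^ k))
      (\<lambda>z. q_single n M k i z * q_single n M k i' z) = (\<Sum>J\<in>?F 1 \<union> ?F 3. c i J * c i' J)"
    unfolding q by (rule expectation_multilinear_product) auto
  moreover have "(\<Sum>J\<in>?F 1. c i J * c i' J) = elem_sym (Suc 0) (\<lambda>j. ?m i j * ?m i' j) ?N"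
    unfolding elem_sym_def by (intro sum.cong) (auto simp: c_def prod.distrib)
  moreover have "(\<Sum>J\<in>?F 3. c i J * c i' J) = 4 * elem_sym 3 (\<lambda>j. ?m i j * ?m i' j) ?N"
    unfolding elem_sym_def sum_distrib_left by (intro sum.cong) (auto simp: c_def prod.distrib)
  ultimately show ?thesis
    unfolding sum.union_disjoint[OF fin fin disj] by (simp add: elem_sym_1)
qed

text \<open>There are \<kappa> summands, each of order \<kappa> to the power
  \<open>-(r + 2)\<close>, so the sum is of order at most 1/\<kappa>. The exponent is written
  \<open>Suc (Suc r)\<close> because the first power sum does not vanish: it is the Gram
  entry.\<close>

lemma sum_M_kappa_power_tendsto_0:
  assumes M: "M \<in> carrier_mat n n" and i: "i < n" "i' < n"
  shows "(\<lambda>k. \<Sum>j<2 ^ k. (M_kappa n M k $$ (i, j) * M_kappa n M k $$ (i', j)) ^ Suc (Suc r))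
    \<longlonglongrightarrow> 0"
proof (rule Lim_null_comparison)
  let ?R = "\<lambda>i. \<Sum>l<n. \<bar>M $$ (i, l)\<bar>"
  define B where "B = ?R i * ?R i'"
  have B: "B \<ge> 0" by (simp add: B_def sum_nonneg)
  show "\<forall>\<^sub>F k in sequentially. norm (\<Sum>j<2 ^ k.
      (M_kappa n M k $$ (i, j) * M_kappa n M k $$ (i', j)) ^ Suc (Suc r)) \<le>
      B ^ Suc (Suc r) * (1 / 2) ^ k"
  \<comment> \<open>Since \<open>k < 2 ^ k\<close>, the threshold \<open>n \<le> k\<close>
    guarantees that the first \<open>n\<close> Hadamard rows exist.\<close>
  proof (rule eventually_sequentiallyI[of n])
    fix k assume "n \<le> k"
    then have k: "n \<le> 2 ^ k"
      using less_exp[of k] by linarith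
    have le: "\<bar>(M_kappa n M k $$ (i, j) * M_kappa n M k $$ (i', j)) ^ Suc (Suc r)\<bar> \<le>
        (B / 2 ^ k) ^ Suc (Suc r)" if "j < 2 ^ k" for j
    proof -
      have "\<bar>M_kappa n M k $$ (i, j)\<bar> * \<bar>M_kappa n M k $$ (i', j)\<bar> \<le>
          (?R i / sqrt (2 ^ k)) * (?R i' / sqrt (2 ^ k))"
        using abs_M_kappa_le[OF M _ that k] i
        by (intro mult_mono) (auto intro!: divide_nonneg_nonneg sum_nonneg)
      also have "\<dots> = B / 2 ^ k"
        by (simp add: B_def)
      finally show ?thesis
        unfolding power_abs abs_mult by (intro power_mono) auto
    qed
    have "norm (\<Sum>j<2 ^ k. (M_kappa n M k $$ (i, j) * M_kappa n M k $$ (i', j)) ^ Suc (Suc r)) \<le>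
        (\<Sum>j<2 ^ k :: nat. (B / 2 ^ k) ^ Suc (Suc r))"
      unfolding real_norm_def by (rule order_trans[OF sum_abs sum_mono]) (use le in auto)
    also have "\<dots> = B ^ Suc (Suc r) * (1 / 2) ^ k * (1 / 2 ^ k) ^ r"
      by (simp add: power_divide field_simps)
    also have "\<dots> \<le> B ^ Suc (Suc r) * (1 / 2) ^ k"
      using B by (intro mult_left_le) (auto intro: power_le_one)
    finally show "norm (\<Sum>j<2 ^ k.
        (M_kappa n M k $$ (i, j) * M_kappa n M k $$ (i', j)) ^ Suc (Suc r)) \<le>
        B ^ Suc (Suc r) * (1 / 2) ^ k" .
  qed
  show "(\<lambda>k. B ^ Suc (Suc r) * (1 / 2) ^ k) \<longlonglongrightarrow> 0"
    by (intro tendsto_mult_right_zero LIMSEQ_realpow_zero) auto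
qed

lemma expectation_q_single_product_tendsto:
  assumes M: "M \<in> carrier_mat n n" and i: "i < n" "i' < n"
    and x: "x = (M * transpose_mat M) $$ (i, i')"
  shows "(\<lambda>k. measure_pmf.expectation (uniform_signs (2 ^ k))
      (\<lambda>z. q_single n M k i z * q_single n M k i' z)) \<longlonglongrightarrow> x + 2 / 3 * x ^ 3"
proof (rule Lim_transform_eventually)
  let ?p = "\<lambda>r k. \<Sum>j<2 ^ k. (M_kappa n M k $$ (i, j) * M_kappa n M k $$ (i', j)) ^ r"
  \<comment> \<open>The coefficient 2/3 is 4/6: the 4 multiplies \<open>elem_sym 3\<close> in the
    expectation, and the 6 comes from Newton's identity. The first power sum equals
    \<open>x\<close>, and the second and third tend to 0.\<close>
  have "(\<lambda>k. x + 2 / 3 * (x ^ 3 - 3 * x * ?p 2 k + 2 * ?p 3 k)) \<longlonglongrightarrow>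
      x + 2 / 3 * (x ^ 3 - 3 * x * 0 + 2 * 0)"
    using sum_M_kappa_power_tendsto_0[OF M i, of 0] sum_M_kappa_power_tendsto_0[OF M i, of 1]
    by (intro tendsto_intros) (simp_all add: eval_nat_numeral)
  then show "(\<lambda>k. x + 2 / 3 * (x ^ 3 - 3 * x * ?p 2 k + 2 * ?p 3 k)) \<longlonglongrightarrow> x + 2 / 3 * x ^ 3"
    by simp
  show "\<forall>\<^sub>F k in sequentially. x + 2 / 3 * (x ^ 3 - 3 * x * ?p 2 k + 2 * ?p 3 k) =
      measure_pmf.expectation (uniform_signs (2 ^ k))
        (\<lambda>z. q_single n M k i z * q_single n M k i' z)"
  proof (rule eventually_sequentiallyI[of n])
    fix k assume "n \<le> k"
    then have k: "n \<le> 2 ^ k"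
      using less_exp[of k] by linarith
    let ?a = "\<lambda>j. M_kappa n M k $$ (i, j) * M_kappa n M k $$ (i', j)"
    have "6 * elem_sym 3 ?a {..<2 ^ k} = x ^ 3 - 3 * x * ?p 2 k + 2 * ?p 3 k"
      by (subst elem_sym_3) (simp_all only: finite_lessThan M_kappa_row_product[OF M i k] x)
    then show "x + 2 / 3 * (x ^ 3 - 3 * x * ?p 2 k + 2 * ?p 3 k) =
        measure_pmf.expectation (uniform_signs (2 ^ k))
          (\<lambda>z. q_single n M k i z * q_single n M k i' z)"
      unfolding expectation_q_single_product M_kappa_row_product[OF M i k] x by simp
  qed
qed

text \<open>For \<open>i = j\<close> the symmetric difference is empty and \<open>q_set\<close> is
  the constant 1. The limit of the pair moments, which would give 5/3 at \<open>x = 1\<close>,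
  applies only off the diagonal.\<close>

lemma M1_singletons:
  assumes M: "M \<in> carrier_mat n n" and i: "i < n" "j < n"
    and x: "x = (M * transpose_mat M) $$ (i, j)"
  shows "M1 n M ({i}, {j}) = (if i = j then 1 else x + 2 / 3 * x ^ 3)"
proof -
  have "M1 n M ({i}, {j}) = lim (\<lambda>k. measure_pmf.expectation (uniform_signs (2 ^ k))
      (q_set n M k (sym_diff {i} {j})))"
    using i by (simp add: M1_def index_sets_def)
  also have "\<dots> = (if i = j then 1 else x + 2 / 3 * x ^ 3)"
  proof (cases "i = j")
    case True
    then have "q_set n M k (sym_diff {i} {j}) = (\<lambda>_. 1)" for k
      by (simp add: q_set_def fun_eq_iff)
    then show ?thesis
      using True by simp
  next
    case False
    then have "sym_diff {i} {j} = {i, j}" by auto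
    then have "q_set n M k (sym_diff {i} {j}) = (\<lambda>z. q_single n M k i z * q_single n M k j z)" for k
      using False by (simp add: q_set_def fun_eq_iff)
    then show ?thesis
      using False limI[OF expectation_q_single_product_tendsto[OF M i x]] by simp
  qed
  finally show ?thesis .
qed

section \<open>Bounds on the off-diagonal cubic error\<close>

lemma alpha_mag_ge: "i < n \<Longrightarrow> j < n \<Longrightarrow> i \<noteq> j \<Longrightarrow> \<bar>X $$ (i, j)\<bar> \<le> alpha_mag n X"
  and alpha_mag_nonneg: "0 \<le> alpha_mag n X"
proof -
  have "finite {\<bar>X $$ (i, j)\<bar> | i j. i < n \<and> j < n \<and> i \<noteq> j}"
    by (rule finite_subset[of _ "(\<lambda>(i, j). \<bar>X $$ (i, j)\<bar>) ` ({..<n} \<times> {..<n})"]) auto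
  then have fin: "finite (insert 0 {\<bar>X $$ (i, j)\<bar> | i j. i < n \<and> j < n \<and> i \<noteq> j})"
    by simp
  show "i < n \<Longrightarrow> j < n \<Longrightarrow> i \<noteq> j \<Longrightarrow> \<bar>X $$ (i, j)\<bar> \<le> alpha_mag n X" "0 \<le> alpha_mag n X"
    unfolding alpha_mag_def by (rule Max_ge[OF fin]; blast)+
qed

lemma row_sum_le_alpha_row:
  assumes "i < n"
  shows "(\<Sum>j\<in>{..<n} - {i}. (X $$ (i, j))\<^sup>2) \<le> (alpha_row n X)\<^sup>2"
proof -
  have "sqrt (\<Sum>j\<in>{..<n} - {i}. (X $$ (i, j))\<^sup>2) \<le> alpha_row n X"
    unfolding alpha_row_def using assms by (intro Max_ge) auto
  then show ?thesis
    using sqrt_le_D by blast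
qed

text \<open>The absolute value on the right lets the bound be squared without first showing that
  \<open>alpha_row\<close> is nonnegative.\<close>

lemma entry_le_alpha_row:
  assumes "i < n" "j < n" "i \<noteq> j"
  shows "\<bar>X $$ (i, j)\<bar> \<le> \<bar>alpha_row n X\<bar>"
proof -
  have "(X $$ (i, j))\<^sup>2 \<le> (\<Sum>j\<in>{..<n} - {i}. (X $$ (i, j))\<^sup>2)"
    using assms by (intro member_le_sum) auto
  then show ?thesis
    using row_sum_le_alpha_row[OF assms(1), of X] abs_le_square_iff by fastforce
qed

text \<open>Of the three squares in a sixth power, one is bounded by \<open>alpha_mag\<close>, one
  by \<open>alpha_row\<close>, and the last is summed over its row, which gives
  \<open>alpha_row\<close> again. The outer sum contributes the factor \<open>n\<close>.\<close>

lemma sum_offdiag_power6_le: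
  "(\<Sum>i<n. \<Sum>j\<in>{..<n} - {i}. (X $$ (i, j)) ^ 6) \<le>
    real n * (alpha_mag n X * (1 + alpha_row n X ^ 4))\<^sup>2"
proof -
  let ?m = "alpha_mag n X" and ?r = "alpha_row n X"
  have "(X $$ (i, j)) ^ 6 \<le> ?m\<^sup>2 * ?r\<^sup>2 * (X $$ (i, j))\<^sup>2" if "i < n" "j < n" "i \<noteq> j" for i j
  proof -
    have "(X $$ (i, j))\<^sup>2 \<le> ?m\<^sup>2" "(X $$ (i, j))\<^sup>2 \<le> ?r\<^sup>2"
      using alpha_mag_ge[OF that, of X] alpha_mag_nonneg[of n X] entry_le_alpha_row[OF that, of X]
      by (simp_all add: abs_le_square_iff[symmetric])
    then have "(X $$ (i, j))\<^sup>2 * (X $$ (i, j))\<^sup>2 * (X $$ (i, j))\<^sup>2 \<le> ?m\<^sup>2 * ?r\<^sup>2 * (X $$ (i, j))\<^sup>2"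
      by (intro mult_mono) auto
    then show ?thesis
      by (simp add: power_add[symmetric])
  qed
  then have "(\<Sum>i<n. \<Sum>j\<in>{..<n} - {i}. (X $$ (i, j)) ^ 6) \<le>
      (\<Sum>i<n. ?m\<^sup>2 * ?r\<^sup>2 * (\<Sum>j\<in>{..<n} - {i}. (X $$ (i, j))\<^sup>2))"
    unfolding sum_distrib_left by (intro sum_mono) auto
  also have "\<dots> \<le> (\<Sum>i<n. ?m\<^sup>2 * ?r\<^sup>2 * ?r\<^sup>2)"
    by (intro sum_mono mult_left_mono row_sum_le_alpha_row) auto
  also have "\<dots> = real n * (?m * ?r\<^sup>2)\<^sup>2"
    by (simp add: power_mult_distrib power_add[symmetric] power_mult[symmetric])
  also have "\<dots> \<le> real n * (?m * (1 + ?r ^ 4))\<^sup>2"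
  proof -
    \<comment> \<open>The inequality of arithmetic and geometric means turns the natural bound into
      the shape of the factor in \<open>alpha\<close>.\<close>
    have "2 * ?r\<^sup>2 \<le> 1 + ?r ^ 4"
      using sum_squares_bound[of 1 "?r\<^sup>2"] by (simp add: power_mult[symmetric])
    then have "?r\<^sup>2 \<le> 1 + ?r ^ 4"
      using zero_le_power2[of ?r] by linarith
    then show ?thesis
      using alpha_mag_nonneg by (intro mult_left_mono power_mono) auto
  qed
  finally show ?thesis .
qed

text \<open>Cauchy-Schwarz over the off-diagonal index pairs: the squares of \<open>A\<close> are at
  most the full squared Frobenius norm, and the squared cubes are the sixth powers bounded
  before.\<close>

lemma abs_sum_offdiag_cube_le:
  assumes A: "A \<in> carrier_mat n n"
  shows "\<bar>\<Sum>i<n. \<Sum>j\<in>{..<n} - {i}. A $$ (i, j) * (X $$ (i, j)) ^ 3\<bar> \<le>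
    sqrt (real n) * frob_norm A * (alpha_mag n X * (1 + alpha_row n X ^ 4))"
proof -
  let ?I = "SIGMA i:{..<n}. {..<n} - {i}"
  let ?b = "alpha_mag n X * (1 + alpha_row n X ^ 4)"
  have b: "?b \<ge> 0"
    using alpha_mag_nonneg by (intro mult_nonneg_nonneg add_nonneg_nonneg) auto
  have "(\<Sum>i<n. \<Sum>j\<in>{..<n} - {i}. A $$ (i, j) * (X $$ (i, j)) ^ 3)\<^sup>2 =
      (\<Sum>p\<in>?I. A $$ p * (X $$ p) ^ 3)\<^sup>2"
    by (simp add: sum.Sigma case_prod_unfold)
  also have "\<dots> \<le> (\<Sum>p\<in>?I. (A $$ p)\<^sup>2) * (\<Sum>p\<in>?I. ((X $$ p) ^ 3)\<^sup>2)"
    by (rule Cauchy_Schwarz_ineq_sum)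
  also have "\<dots> \<le> (frob_norm A)\<^sup>2 * (real n * ?b\<^sup>2)"
  proof (intro mult_mono)
    have "(\<Sum>p\<in>?I. (A $$ p)\<^sup>2) \<le> (\<Sum>p\<in>{..<n} \<times> {..<n}. (A $$ p)\<^sup>2)"
      by (intro sum_mono2) auto
    also have "\<dots> = (frob_norm A)\<^sup>2"
      using A by (simp add: frob_norm_def sum_nonneg sum.cartesian_product case_prod_unfold)
    finally show "(\<Sum>p\<in>?I. (A $$ p)\<^sup>2) \<le> (frob_norm A)\<^sup>2" .
    show "(\<Sum>p\<in>?I. ((X $$ p) ^ 3)\<^sup>2) \<le> real n * ?b\<^sup>2"
      using sum_offdiag_power6_le[of X n]
      by (simp add: sum.Sigma case_prod_unfold power_mult[symmetric])
  qed (auto intro: sum_nonneg)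
  also have "\<dots> = (sqrt (real n) * frob_norm A * ?b)\<^sup>2"
    by (simp add: power_mult_distrib)
  finally have "\<bar>\<Sum>i<n. \<Sum>j\<in>{..<n} - {i}. A $$ (i, j) * (X $$ (i, j)) ^ 3\<bar> \<le>
      \<bar>sqrt (real n) * frob_norm A * ?b\<bar>"
    by (simp only: abs_le_square_iff)
  also have "\<dots> = sqrt (real n) * frob_norm A * ?b"
    using mult_nonneg_nonneg[OF _ b, of "sqrt (real n) * frob_norm A"]
    by (intro abs_of_nonneg) (simp add: frob_norm_def sum_nonneg)
  finally show ?thesis .
qed

section \<open>The pairing of \<open>A\<close> with \<open>Phi\<close> and the final
  inequality\<close>

lemma sum_Phi_singletons:
  assumes A: "A \<in> carrier_mat n n" and M: "M \<in> carrier_mat n n"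
    and X: "X = M * transpose_mat M" and diag: "\<And>i. i < n \<Longrightarrow> X $$ (i, i) = 1"
  shows "(\<Sum>i<n. \<Sum>j<n. A $$ (i, j) * Phi n a M ({i}, {j})) =
    1 / (1 + a) * ((\<Sum>i<n. \<Sum>j<n. A $$ (i, j) * X $$ (i, j)) +
      2 / 3 * (\<Sum>i<n. \<Sum>j\<in>{..<n} - {i}. A $$ (i, j) * (X $$ (i, j)) ^ 3)) +
    a / (1 + a) * trace_mat A"
proof -
  have row: "(\<Sum>j<n. A $$ (i, j) * Phi n a M ({i}, {j})) =
      1 / (1 + a) * ((\<Sum>j<n. A $$ (i, j) * X $$ (i, j)) +
        2 / 3 * (\<Sum>j\<in>{..<n} - {i}. A $$ (i, j) * (X $$ (i, j)) ^ 3)) + a / (1 + a) * A $$ (i, i)"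
    if i: "i < n" for i
  proof -
    \<comment> \<open>The two diagonal terms stay separate: \<open>1 / (1 + a)\<close> supplies the
      diagonal part of the pairing with \<open>X\<close>, whose diagonal is 1, and
      \<open>a / (1 + a)\<close> goes into the trace. They are not added up to 1, since
      \<open>a\<close> is arbitrary here and \<open>1 + a\<close> could be 0.\<close>
    have Phi: "Phi n a M ({i}, {j}) =
        (if j = i then 1 / (1 + a) + a / (1 + a)
         else 1 / (1 + a) * (X $$ (i, j) + 2 / 3 * (X $$ (i, j)) ^ 3))" if "j < n" for j
      using M1_singletons[OF M i that refl] i that
      by (auto simp: Phi_def Id_sets_def index_sets_def X)
    have "(\<Sum>j<n. A $$ (i, j) * Phi n a M ({i}, {j})) =
        A $$ (i, i) * Phi n a M ({i}, {i}) +
        (\<Sum>j\<in>{..<n} - {i}. A $$ (i, j) * Phi n a M ({i}, {j}))"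
      using i by (simp add: sum.remove)
    also have "(\<Sum>j\<in>{..<n} - {i}. A $$ (i, j) * Phi n a M ({i}, {j})) =
        (\<Sum>j\<in>{..<n} - {i}. 1 / (1 + a) *
          (A $$ (i, j) * X $$ (i, j) + 2 / 3 * (A $$ (i, j) * (X $$ (i, j)) ^ 3)))"
      by (intro sum.cong refl) (auto simp: Phi algebra_simps add_divide_distrib)
    also have "\<dots> = 1 / (1 + a) * ((\<Sum>j\<in>{..<n} - {i}. A $$ (i, j) * X $$ (i, j)) +
        2 / 3 * (\<Sum>j\<in>{..<n} - {i}. A $$ (i, j) * (X $$ (i, j)) ^ 3))"
      by (simp only: sum_distrib_left[symmetric] sum.distrib)
    finally show ?thesis
      using i diag[OF i] sum.remove[of "{..<n}" i "\<lambda>j. A $$ (i, j) * X $$ (i, j)"]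
      by (simp add: Phi algebra_simps add_divide_distrib)
  qed
  have "(\<Sum>i<n. \<Sum>j<n. A $$ (i, j) * Phi n a M ({i}, {j})) =
      (\<Sum>i<n. 1 / (1 + a) * ((\<Sum>j<n. A $$ (i, j) * X $$ (i, j)) +
        2 / 3 * (\<Sum>j\<in>{..<n} - {i}. A $$ (i, j) * (X $$ (i, j)) ^ 3)) + a / (1 + a) * A $$ (i, i))"
    by (intro sum.cong refl row) simp
  then show ?thesis
    using A by (simp only: sum.distrib sum_distrib_left[symmetric] trace_mat_def carrier_matD)
qed

theorem theorem1p3:
  shows "\<exists>C::real. C > 0 \<and>
    (\<forall>(n::nat) (X::real mat) (M::real mat).
      n \<ge> 1 \<longrightarrow> X \<in> carrier_mat n n \<longrightarrow> psd_mat X \<longrightarrow> (\<forall>i<n. X $$ (i, i) = 1) \<longrightarrow>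
      M \<in> carrier_mat n n \<longrightarrow> X = M * transpose_mat M \<longrightarrow>
      (let a = alpha C n X in
        \<forall>A::real mat. A \<in> carrier_mat n n \<longrightarrow> symmetric_mat A \<longrightarrow>
          (\<Sum>i<n. \<Sum>j<n. A $$ (i, j) * Phi n a M ({i}, {j}))
          \<ge> 1 / (1 + a) * (\<Sum>i<n. \<Sum>j<n. A $$ (i, j) * X $$ (i, j))
             - a / (1 + a) * (sqrt (real n) * frob_norm A - trace_mat A)))"
  unfolding Let_def
proof (intro exI[of _ "1::real"] conjI allI impI)
  fix n :: nat and X M A :: "real mat"
  assume "\<forall>i<n. X $$ (i, i) = 1" and M: "M \<in> carrier_mat n n" and X: "X = M * transpose_mat M"
    and A: "A \<in> carrier_mat n n"
  then have diag: "\<And>i. i < n \<Longrightarrow> X $$ (i, i) = 1" by blast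
  define a where "a = alpha 1 n X"
  let ?b = "alpha_mag n X * (1 + alpha_row n X ^ 4)"
  let ?AX = "\<Sum>i<n. \<Sum>j<n. A $$ (i, j) * X $$ (i, j)"
  let ?D = "\<Sum>i<n. \<Sum>j\<in>{..<n} - {i}. A $$ (i, j) * (X $$ (i, j)) ^ 3"
  let ?f = "sqrt (real n) * frob_norm A"
  have b: "?b \<ge> 0"
    using alpha_mag_nonneg by (intro mult_nonneg_nonneg add_nonneg_nonneg) auto
  have "?b * 1 \<le> ?b * (1 + (spec_norm X)\<^sup>2)"
    using b by (intro mult_left_mono) auto
  then have ba: "?b \<le> a"
    by (simp add: a_def alpha_def)
  have f: "?f \<ge> 0"
    by (simp add: frob_norm_def sum_nonneg)
  have "\<bar>?D\<bar> \<le> ?f * a"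
    using abs_sum_offdiag_cube_le[OF A, of X] mult_left_mono[OF ba f] by linarith
  \<comment> \<open>The bound on \<open>\<bar>?D\<bar>\<close> also forces \<open>a * ?f\<close> to
    be nonnegative, so the coefficient 2/3 < 1 leaves room with the constant 1.\<close>
  then have "0 \<le> 2 / 3 * ?D + a * ?f"
    by (simp add: mult.commute)
  then have "0 \<le> (2 / 3 * ?D + a * ?f) / (1 + a)"
    using b ba by (intro divide_nonneg_nonneg) auto
  \<comment> \<open>The trace terms on both sides agree, and the difference of the two sides is
    exactly the nonnegative quotient just obtained.\<close>
  then have "1 / (1 + a) * ?AX - a / (1 + a) * (?f - trace_mat A) \<le>
      1 / (1 + a) * (?AX + 2 / 3 * ?D) + a / (1 + a) * trace_mat A"
    by (simp add: algebra_simps add_divide_distrib)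
  then show "1 / (1 + alpha 1 n X) * ?AX - alpha 1 n X / (1 + alpha 1 n X) * (?f - trace_mat A) \<le>
      (\<Sum>i<n. \<Sum>j<n. A $$ (i, j) * Phi n (alpha 1 n X) M ({i}, {j}))"
    unfolding a_def by (subst sum_Phi_singletons[OF A M X]) (use diag in auto)
qed simp

end
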